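(* For each positive integer $h$, every icosahedron with $h$ tadpole hats is pentagon-expanding; that is, if $G$ is an icosahedron with $h$ tadpole hats, then $\lim_{k\to\infty}|V(\mathscr{C}_5^k(G))|=\infty$.
   Context: All graphs are finite and simple. For a graph $G$, the pentagon graph $\mathscr{C}_5(G)$ is the graph whose vertices are the induced cycles of length $5$ in $G$ (regarded as subgraphs), where two distinct vertices are adjacent if and only if the corresponding induced $5$-cycles share at least one common edge. If $G$ has no induced $5$-cycles, then $\mathscr{C}_5(G)=\emptyset$ (the graph with no vertices). Iterates are defined by $\mathscr{C}_5^0(G)=G$ and $\mathscr{C}_5^{k+1}(G)=\mathscr{C}_5(\mathscr{C}_5^k(G))$. Let $I$ be the graph ($1$-skeleton) of the regular icosahedron ($12$ vertices, $5$-regular). The tadpole graph $T_{3,1}$ is the graph on four vertices $x,y,z,u$ with edges $xy, yz, zx, xu$ (a triangle with one pendant edge). An induced tadpole in $I$ is an induced subgraph of $I$ isomorphic to $T_{3,1}$. A tadpole hat of $I$ is a new vertex $v\notin V(I)$ whose set of neighbours in $V(I)$ is exactly the vertex set of an induced tadpole in $I$. An icosahedron with $h$ tadpole hats is a graph whose vertex set consists of $V(I)$ together with $h$ further distinct vertices, such that the subgraph induced by $V(I)$ is $I$ and each of the $h$ further vertices is a tadpole hat of $I$ (no restriction is placed on adjacency among the hats, and different hats may be attached to the same tadpole). A graph $G$ is pentagon-expanding if $\lim_{k\to\infty}|V(\mathscr{C}_5^k(G))|=\infty$. *)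

theory Defs
  imports
    "HOL-Analysis.Analysis"
    "HOL-Library.FSet"
    "Graph_Theory.Pair_Digraph"
    "Graph_Theory.Digraph_Isomorphism"
begin

text \<open>
  A finite simple graph is a \<^locale>\<open>pair_graph\<close>: an undirected edge is represented by its two
  opposite arcs, and there are no loops.
\<close>

definition undirected :: "'a set \<Rightarrow> 'a rel \<Rightarrow> 'a pair_pre_digraph" where
  "undirected V E = \<lparr>pverts = V, parcs = E \<union> E\<inverse>\<rparr>"

definition cycle5 :: "nat pair_pre_digraph" where
  "cycle5 = undirected {..<5} {(0,1), (1,2), (2,3), (3,4), (4,0)}"

definition tadpole_3_1 :: "nat pair_pre_digraph" where
  "tadpole_3_1 = undirected {..<4} {(0,1), (1,2), (2,0), (0,3)}"

text \<open>
  The pole 0 is joined to the pentagon 1--5, the pole 11 to the pentagon 6--10,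
  and the two pentagons are joined by the ten slanted edges of the antiprism.
\<close>

definition icosahedron :: "nat pair_pre_digraph" where
  "icosahedron = undirected {..<12}
     {(0,1), (0,2), (0,3), (0,4), (0,5),
      (1,2), (2,3), (3,4), (4,5), (5,1),
      (1,6), (1,7), (2,7), (2,8), (3,8), (3,9), (4,9), (4,10), (5,10), (5,6),
      (6,7), (7,8), (8,9), (9,10), (10,6),
      (11,6), (11,7), (11,8), (11,9), (11,10)}"

text \<open>
  The twelve cyclic permutations of \<open>(0, \<plusminus>1, \<plusminus>\<phi>)\<close> are the vertices of a regular icosahedron
  with edge length 2; the next lemma confirms that its edges are those listed above.
\<close>

definition icosahedron_coords :: "(real \<times> real \<times> real) list" where
  "icosahedron_coords = (let \<phi> = (1 + sqrt 5) / 2 in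
     [(0,1,\<phi>), (1,\<phi>,0), (\<phi>,0,1), (0,-1,\<phi>), (-\<phi>,0,1), (-1,\<phi>,0),
      (0,1,-\<phi>), (\<phi>,0,-1), (1,-\<phi>,0), (-1,-\<phi>,0), (-\<phi>,0,-1), (0,-1,-\<phi>)])"

lemma icosahedron_arcs_iff_dist:
  assumes "i < 12" "j < 12"
  shows "(i, j) \<in> parcs icosahedron \<longleftrightarrow> dist (icosahedron_coords ! i) (icosahedron_coords ! j) = 2"
proof -
  define p where "p = (1 + sqrt 5) / 2"
  have pp: "p * p = p + 1"
    by (simp add: p_def field_simps)
  have ppx: "p * (p * x) = p * x + x" for x
    using pp by (metis mult.assoc distrib_right mult_1)
  have p1: "p > 1"
    by (simp add: p_def)
  have sq: "dist x y = 2 \<longleftrightarrow> (fst x - fst y)\<^sup>2 + (fst (snd x) - fst (snd y))\<^sup>2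
      + (snd (snd x) - snd (snd y))\<^sup>2 = 4" for x y :: "real \<times> real \<times> real"
  proof -
    have "dist x y = 2 \<longleftrightarrow> (dist x y)\<^sup>2 = 2\<^sup>2"
      by (subst power2_eq_iff_nonneg) auto
    then show ?thesis
      by (cases x, cases "snd x", cases y, cases "snd y")
        (simp add: dist_Pair_Pair dist_real_def add.assoc)
  qed
  have co: "icosahedron_coords =
     [(0,1,p), (1,p,0), (p,0,1), (0,-1,p), (-p,0,1), (-1,p,0),
      (0,1,-p), (p,0,-1), (1,-p,0), (-1,-p,0), (-p,0,-1), (0,-1,-p)]"
    by (simp add: icosahedron_coords_def p_def Let_def)
  have upto: "{..<12} = {0,1,2,3,4,5,6,7,8,9,10,11::nat}"
    by (simp add: set_eq_iff) presburger
  have "\<forall>i\<in>{..<12}. \<forall>j\<in>{..<12}. (i, j) \<in> parcs icosahedron \<longleftrightarrow>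
      dist (icosahedron_coords ! i) (icosahedron_coords ! j) = 2"
    using p1 unfolding sq co icosahedron_def undirected_def upto
    by (simp add: power2_eq_square algebra_simps pp ppx)
  then show ?thesis
    using assms by simp
qed

definition pentagon_graph :: "'a pair_pre_digraph \<Rightarrow> 'a pair_pre_digraph pair_pre_digraph" where
  "pentagon_graph G =
     (let P = {C :: 'a pair_pre_digraph. induced_subgraph (with_proj C) (with_proj G) \<and>
                digraph_iso (with_proj C) (with_proj cycle5)}
      in \<lparr>pverts = P,
          parcs = {(C, D). C \<in> P \<and> D \<in> P \<and> C \<noteq> D \<and> parcs C \<inter> parcs D \<noteq> {}}\<rparr>)"

text \<open>
  Each application of \<^const>\<open>pentagon_graph\<close> changes the vertex type. To iterate it, all vertices are
  named in the following type: \<open>Pentagon V A\<close> names the subgraph with vertex set \<open>V\<close> and arc set \<open>A\<close>.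
\<close>

datatype 'a pentagon_vertex =
    Original 'a
  | Pentagon "'a pentagon_vertex fset" "('a pentagon_vertex \<times> 'a pentagon_vertex) fset"

definition pentagon_name :: "'a pentagon_vertex pair_pre_digraph \<Rightarrow> 'a pentagon_vertex" where
  "pentagon_name C = Pentagon (Abs_fset (pverts C)) (Abs_fset (parcs C))"

definition rename :: "('a \<Rightarrow> 'b) \<Rightarrow> 'a pair_pre_digraph \<Rightarrow> 'b pair_pre_digraph" where
  "rename f G = \<lparr>pverts = f ` pverts G, parcs = map_prod f f ` parcs G\<rparr>"

primrec iterated_pentagon_graph ::
    "nat \<Rightarrow> 'a pair_pre_digraph \<Rightarrow> 'a pentagon_vertex pair_pre_digraph" where
  "iterated_pentagon_graph 0 G = rename Original G"
| "iterated_pentagon_graph (Suc k) G =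
     rename pentagon_name (pentagon_graph (iterated_pentagon_graph k G))"

definition pentagon_expanding :: "'a pair_pre_digraph \<Rightarrow> bool" where
  "pentagon_expanding G \<longleftrightarrow>
     filterlim (\<lambda>k. card (pverts (iterated_pentagon_graph k G))) at_top sequentially"

text \<open>The renaming is harmless: on finite simple graphs it is an isomorphism.\<close>

lemma pair_graph_pentagon_graph:
  assumes "pair_graph G"
  shows "pair_graph (pentagon_graph G)"
proof -
  interpret pair_graph G by fact
  have "pverts (pentagon_graph G) \<subseteq>
      (\<lambda>(V, A). \<lparr>pverts = V, parcs = A\<rparr>) ` (Pow (pverts G) \<times> Pow (parcs G))" (is "_ \<subseteq> ?f ` ?B")
  proof
    fix C assume "C \<in> pverts (pentagon_graph G)"
    then have "C = ?f (pverts C, parcs C)" "(pverts C, parcs C) \<in> ?B"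
      by (auto simp: pentagon_graph_def induced_subgraph_def subgraph_def)
    then show "C \<in> ?f ` ?B" by blast
  qed
  then have fin: "finite (pverts (pentagon_graph G))"
    by (rule finite_subset) (simp add: pair_finite_verts pair_finite_arcs)
  have sub: "parcs (pentagon_graph G) \<subseteq> pverts (pentagon_graph G) \<times> pverts (pentagon_graph G)"
    by (auto simp: pentagon_graph_def Let_def)
  show ?thesis
  proof
    show "finite (parcs (pentagon_graph G))"
      using sub fin by (meson finite_SigmaI finite_subset)
    show "symmetric (with_proj (pentagon_graph G))"
      by (auto simp: symmetric_def sym_def pentagon_graph_def Let_def)
  qed (use sub fin in \<open>auto simp: pentagon_graph_def Let_def\<close>)
qed

lemma inj_on_pentagon_name:
  assumes "pair_graph G"
  shows "inj_on pentagon_name (pverts (pentagon_graph G))"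
proof
  interpret pair_graph G by fact
  have fin: "finite (pverts C)" "finite (parcs C)" if "C \<in> pverts (pentagon_graph G)" for C
    using that pair_finite_verts pair_finite_arcs
    by (auto simp: pentagon_graph_def induced_subgraph_def subgraph_def intro: finite_subset)
  fix C D
  assume "C \<in> pverts (pentagon_graph G)" "D \<in> pverts (pentagon_graph G)"
    "pentagon_name C = pentagon_name D"
  then show "C = D"
    using fin by (auto simp: pentagon_name_def Abs_fset_inject)
qed

lemma rename_iso:
  assumes "pair_graph G" "inj_on f (pverts G)"
  shows "pair_graph (rename f G)" "digraph_iso (with_proj G) (with_proj (rename f G))"
proof -
  interpret pair_graph G by fact
  have sub: "parcs G \<subseteq> pverts G \<times> pverts G"
    using in_arcsD1 in_arcsD2 by auto
  show "pair_graph (rename f G)"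
  proof
    show "symmetric (with_proj (rename f G))"
      using arcs_symmetric by (force simp: symmetric_def sym_def rename_def)
    show "fst e \<noteq> snd e" if "e \<in> parcs (rename f G)" for e
      using that sub no_loops' assms(2) by (fastforce simp: rename_def dest: inj_onD)
  qed (use sub pair_finite_verts pair_finite_arcs in \<open>auto simp: rename_def\<close>)
  let ?h = "\<lparr>iso_verts = f, iso_arcs = map_prod f f, iso_head = snd, iso_tail = fst\<rparr>"
  have "inj_on (map_prod f f) (parcs G)"
    using map_prod_inj_on[OF assms(2) assms(2)] sub inj_on_subset by blast
  then have "pre_digraph.digraph_isomorphism (with_proj G) ?h"
    using assms(2) wf_digraph_wp_iff pair_wf_digraph
    by (auto simp: pre_digraph.digraph_isomorphism_def)
  moreover have "with_proj (rename f G) = app_iso ?h (with_proj G)"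
    by (simp add: with_proj_def app_iso_def rename_def)
  ultimately show "digraph_iso (with_proj G) (with_proj (rename f G))"
    by (auto simp: digraph_iso_def)
qed

lemma pair_graph_iterated_pentagon_graph:
  assumes "pair_graph G"
  shows "pair_graph (iterated_pentagon_graph k G)"
  using assms
  by (induction k)
    (auto intro!: rename_iso(1) pair_graph_pentagon_graph inj_on_pentagon_name simp: inj_on_def[of Original])

lemma iterated_pentagon_graph_iso:
  assumes "pair_graph G"
  shows "digraph_iso (with_proj G) (with_proj (iterated_pentagon_graph 0 G))"
    and "digraph_iso (with_proj (pentagon_graph (iterated_pentagon_graph k G)))
           (with_proj (iterated_pentagon_graph (Suc k) G))"
  using assms pair_graph_iterated_pentagon_graph[OF assms, of k]
  by (auto intro!: rename_iso(2) pair_graph_pentagon_graph inj_on_pentagon_name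
      simp: inj_on_def[of Original])

text \<open>\<open>S\<close> is the vertex set of a copy of the icosahedron in \<open>G\<close>.\<close>

definition tadpole_hat :: "'a pair_pre_digraph \<Rightarrow> 'a set \<Rightarrow> 'a \<Rightarrow> bool" where
  "tadpole_hat G S v \<longleftrightarrow> v \<in> pverts G - S \<and>
     (\<exists>T :: 'a pair_pre_digraph. induced_subgraph (with_proj T) (with_proj G \<restriction> S) \<and>
        digraph_iso (with_proj T) (with_proj tadpole_3_1) \<and>
        {u \<in> S. (v, u) \<in> parcs G} = pverts T)"

definition icosahedron_with_tadpole_hats :: "nat \<Rightarrow> 'a pair_pre_digraph \<Rightarrow> bool" where
  "icosahedron_with_tadpole_hats h G \<longleftrightarrow> pair_graph G \<and>
     (\<exists>S \<subseteq> pverts G. digraph_iso (with_proj G \<restriction> S) (with_proj icosahedron) \<and>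
        card (pverts G - S) = h \<and>
        (\<forall>v \<in> pverts G - S. tadpole_hat G S v))"

end

theory Submission
  imports Defs
begin

text \<open>
  The links of the twelve vertices of an icosahedron are induced pentagons, and they form an
  icosahedron in the pentagon graph. Let \<open>v\<close> be a hat over a tadpole whose vertex of degree three is \<open>x\<close>. For two
  neighbours \<open>m\<close> of \<open>x\<close>, replacing \<open>x\<close> by \<open>v\<close> in the link of \<open>m\<close> gives an induced pentagon through \<open>v\<close>,
  and the vertices of the new icosahedron that share an edge with it again form an induced tadpole.
  As different hats give different pentagons, every step at least doubles the number of hats.
\<close>

section \<open>The icosahedron as a table of links, with finite checks\<close>

text \<open>Row \<open>w\<close> is the link of the vertex \<open>w\<close>, listed in cyclic order.\<close>

definition links :: "nat list list" where
  "links = [[1,2,3,4,5], [0,2,7,6,5], [0,1,7,8,3], [0,2,8,9,4],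
     [0,3,9,10,5], [0,1,6,10,4], [1,5,10,11,7], [1,2,8,11,6],
     [2,3,9,11,7], [3,4,10,11,8], [4,5,6,11,9], [6,7,8,9,10]]"

text \<open>
  Isomorphism from the icosahedron to its distance-two graph. The links of two vertices share an edge
  iff the vertices are at distance two, so the links indexed along \<open>antidual\<close> form an icosahedron
  in the pentagon graph.
\<close>

definition antidual :: "nat list" where
  "antidual = [0,6,8,10,7,9,2,4,1,3,5,11]"

text \<open>Around \<open>x\<close> the entries \<open>l ! 0\<close> and \<open>l ! 1\<close> are
  consecutive, which gives the triangle. Entry \<open>l ! 3\<close> is the one opposite to that edge
  in the pentagon, hence adjacent to neither of its ends, and is the pendant vertex. The rotation
  \<open>k\<close> runs through the five positions.\<close>

definition tadpole_list :: "nat \<Rightarrow> nat \<Rightarrow> nat list" where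
  "tadpole_list x k = (let l = rotate k (links ! x) in [x, l ! 0, l ! 1, l ! 3])"

text \<open>
  The vertices whose links meet the tadpole \<open>tadpole_list x k\<close> in \<open>x\<close> and the two neighbours of \<open>x\<close>
  in that link: there a hat of the tadpole can take the place of \<open>x\<close>.
\<close>

definition hat_centres :: "nat \<Rightarrow> nat \<Rightarrow> nat list" where
  "hat_centres x k = (let l = rotate k (links ! x) in [l ! 2, l ! 4])"

text \<open>Vertex sets are lists here and all quantifiers range over list elements, so that
  \<open>code_simp\<close> can evaluate the checks below.\<close>

definition has_edge :: "nat list \<Rightarrow> bool" where
  "has_edge A \<longleftrightarrow> (\<exists>p\<in>set A. \<exists>q\<in>set A. q \<in> set (links ! p))"

definition share_edge :: "nat list \<Rightarrow> nat list \<Rightarrow> bool" where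
  "share_edge A B \<longleftrightarrow> has_edge (filter (\<lambda>p. p \<in> set B) A)"

text \<open>Sorting turns equality of vertex sets into equality of lists. The centre
  \<open>x\<close> belongs to its own tadpole, so searching for it inside \<open>s\<close> loses
  nothing and keeps the evaluation small.\<close>

definition sorted_tadpole :: "nat list \<Rightarrow> bool" where
  "sorted_tadpole s \<longleftrightarrow> (\<exists>x\<in>set s. \<exists>k\<in>set [0..<5]. sort (tadpole_list x k) = s)"

lemma lessThan_12: "{..<12} = {0,1,2,3,4,5,6,7,8,9,10,11::nat}"
  by (simp add: set_eq_iff) presburger

lemma icosahedron_verts: "pverts icosahedron = {..<12}"
  by (simp add: icosahedron_def undirected_def)

lemma icosahedron_arc_iff:
  assumes "i < 12"
  shows "(i, j) \<in> parcs icosahedron \<longleftrightarrow> j \<in> set (links ! i)"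
proof -
  have "i \<in> {..<12}" using assms by simp
  then show ?thesis
    unfolding lessThan_12
    by (elim insertE emptyE; simp add: icosahedron_def undirected_def links_def; linarith)
qed

lemma links_sound:
  "\<forall>w\<in>set [0..<12]. length (links ! w) = 5 \<and> distinct (links ! w) \<and> (\<forall>i\<in>set (links ! w). i < 12) \<and> w \<notin> set (links ! w)"
  by code_simp

lemma links_inj: "\<forall>i\<in>set [0..<12]. \<forall>j\<in>set [0..<12]. set (links ! i) \<subseteq> set (links ! j) \<longrightarrow> i = j"
  by code_simp

lemma antidual_inj: "distinct antidual \<and> length antidual = 12"
  by code_simp

lemma antidual_sound: "\<forall>i\<in>set [0..<12]. antidual ! i < 12"
  by code_simp

lemma links_pentagon:
  "\<forall>w\<in>set [0..<12]. \<forall>i\<in>set [0..<5]. \<forall>j\<in>set [0..<5].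
     links ! w ! j \<in> set (links ! (links ! w ! i)) \<longleftrightarrow> j = (i + 1) mod 5 \<or> i = (j + 1) mod 5"
  by code_simp

lemma links_share_edge:
  "\<forall>i\<in>set [0..<12]. \<forall>j\<in>set [0..<12].
     i \<noteq> j \<and> share_edge (links ! (antidual ! i)) (links ! (antidual ! j)) \<longleftrightarrow> j \<in> set (links ! i)"
  by code_simp

text \<open>
  The conditions on \<open>z\<close> and \<open>u\<close> are filters, not premises, because \<open>code_simp\<close> would evaluate the
  conclusion of an implication even where its premise is false.
\<close>

lemma tadpole_complete:
  "\<forall>x\<in>set [0..<12]. \<forall>y\<in>set (links ! x). \<forall>z\<in>set (filter (\<lambda>z. z \<in> set (links ! y)) (links ! x)).
     \<forall>u\<in>set (filter (\<lambda>u. u \<noteq> y \<and> u \<noteq> z \<and> u \<notin> set (links ! y) \<and> u \<notin> set (links ! z)) (links ! x)).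
     \<exists>k\<in>set [0..<5]. sort (tadpole_list x k) = sort [x, y, z, u]"
  by code_simp

text \<open>The last clause is what makes the exchange work: on the other four vertices of the link
  of \<open>m\<close>, a hat over the tadpole has the same neighbours as \<open>x\<close>.\<close>

lemma hat_centres_sound:
  "\<forall>x\<in>set [0..<12]. \<forall>k\<in>set [0..<5]. \<forall>m\<in>set (hat_centres x k).
     m < 12 \<and> x \<in> set (links ! m) \<and>
     (\<forall>w\<in>set (remove1 x (links ! m)). w \<in> set (tadpole_list x k) \<longleftrightarrow> w \<in> set (links ! x))"
  by code_simp

text \<open>Guarantees that the two pentagons built from one hat differ.\<close>

lemma hat_centres_distinct:
  "\<forall>x\<in>set [0..<12]. \<forall>k\<in>set [0..<5].
     \<not> set (remove1 x (links ! (hat_centres x k ! 0))) \<subseteq> set (remove1 x (links ! (hat_centres x k ! 1)))"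
  by code_simp

text \<open>Without \<open>x\<close> the link of \<open>m\<close> is a path with three edges. Each
  edge lies in the link of \<open>m\<close> and in that of one further vertex; call these vertices
  \<open>a\<close>, \<open>b\<close>, \<open>c\<close> in path order. All three are at distance two
  from \<open>m\<close>, and so are \<open>a\<close> and \<open>c\<close> from each other, while
  \<open>b\<close> is adjacent to \<open>a\<close> and \<open>c\<close>. In the distance-two graph
  this is the triangle \<open>m\<close>, \<open>a\<close>, \<open>c\<close> with \<open>b\<close>
  pendant at \<open>m\<close>.\<close>

lemma hat_centres_tadpole:
  "\<forall>x\<in>set [0..<12]. \<forall>k\<in>set [0..<5]. \<forall>m\<in>set (hat_centres x k).
     sorted_tadpole (filter (\<lambda>i. share_edge (remove1 x (links ! m)) (links ! (antidual ! i))) [0..<12])"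
  by code_simp

section \<open>Induced pentagons and their common edges\<close>

definition induced :: "'a pair_pre_digraph \<Rightarrow> 'a set \<Rightarrow> 'a pair_pre_digraph" where
  "induced G W = \<lparr>pverts = W, parcs = parcs G \<inter> W \<times> W\<rparr>"

lemma lessThan_5: "{..<5} = {0,1,2,3,4::nat}"
  by (simp add: set_eq_iff) presburger

lemma cycle5_arc_iff:
  assumes "i < 5" "j < 5"
  shows "(i, j) \<in> parcs cycle5 \<longleftrightarrow> j = (i + 1) mod 5 \<or> i = (j + 1) mod 5"
proof -
  have "i \<in> {..<5}" "j \<in> {..<5}" using assms by simp_all
  then show ?thesis
    unfolding lessThan_5
    by (elim insertE emptyE; simp add: cycle5_def undirected_def)
qed

lemma pair_graph_cycle5: "pair_graph cycle5"
  by unfold_locales (auto simp: cycle5_def undirected_def symmetric_def sym_def)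

text \<open>The subgraph induced on the image is equal to \<open>rename g cycle5\<close>, so
  \<open>rename_iso\<close> supplies the isomorphism.\<close>

lemma induced_pentagonI:
  assumes "pair_graph G" "inj_on g {..<5}" "g ` {..<5} \<subseteq> pverts G"
    and arcs: "\<And>i j. i < 5 \<Longrightarrow> j < 5 \<Longrightarrow> (g i, g j) \<in> parcs G \<longleftrightarrow> (i, j) \<in> parcs cycle5"
  shows "induced G (g ` {..<5}) \<in> pverts (pentagon_graph G)"
proof -
  interpret pair_graph G by fact
  have verts: "pverts cycle5 = {..<5}"
    by (simp add: cycle5_def undirected_def)
  have sub: "parcs cycle5 \<subseteq> {..<5} \<times> {..<5}"
    by (auto simp: cycle5_def undirected_def)
  have "parcs G \<inter> (g ` {..<5}) \<times> (g ` {..<5}) = map_prod g g ` parcs cycle5"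
  proof (intro subset_antisym subsetI)
    fix e assume "e \<in> parcs G \<inter> (g ` {..<5}) \<times> (g ` {..<5})"
    then obtain i j where "i < 5" "j < 5" "e = (g i, g j)" "(g i, g j) \<in> parcs G"
      by auto
    then show "e \<in> map_prod g g ` parcs cycle5"
      using arcs by (auto intro!: rev_image_eqI[of "(i, j)"])
  next
    fix e assume "e \<in> map_prod g g ` parcs cycle5"
    then obtain i j where ij: "(i, j) \<in> parcs cycle5" "e = (g i, g j)"
      by auto
    then have "i < 5" "j < 5"
      using sub by auto
    then show "e \<in> parcs G \<inter> (g ` {..<5}) \<times> (g ` {..<5})"
      using ij arcs by simp
  qed
  then have eq: "induced G (g ` {..<5}) = rename g cycle5"
    by (simp add: induced_def rename_def verts)
  have inj: "inj_on g (pverts cycle5)"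
    using assms(2) verts by simp
  interpret C: pair_graph cycle5
    by (rule pair_graph_cycle5)
  interpret R: pair_graph "rename g cycle5"
    by (rule rename_iso(1)[OF pair_graph_cycle5 inj])
  have "digraph_iso (with_proj (rename g cycle5)) (with_proj cycle5)"
    by (rule digraph_iso_swap[OF C.wf_digraph rename_iso(2)[OF pair_graph_cycle5 inj]])
  moreover have "induced_subgraph (with_proj (rename g cycle5)) (with_proj G)"
    unfolding induced_subgraph_def subgraph_def
    using assms(3) wf_digraph R.wf_digraph
    by (auto simp: eq[symmetric] induced_def compatible_def)
  ultimately show ?thesis
    by (simp add: pentagon_graph_def Let_def eq)
qed

text \<open>An induced subgraph is determined by its vertex set, and a common edge is just an edge
  of \<open>G\<close> between two common vertices.\<close>

lemma pentagon_graph_arc_iff: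
  assumes "induced G A \<in> pverts (pentagon_graph G)" "induced G B \<in> pverts (pentagon_graph G)"
  shows "(induced G A, induced G B) \<in> parcs (pentagon_graph G) \<longleftrightarrow>
     A \<noteq> B \<and> (\<exists>p\<in>A \<inter> B. \<exists>q\<in>A \<inter> B. (p, q) \<in> parcs G)"
  using assms by (auto simp: pentagon_graph_def Let_def induced_def)

section \<open>Isomorphisms as vertex maps\<close>

text \<open>When arcs are pairs of vertices, the vertex map determines the arc map. The map goes
  from \<open>B\<close> to \<open>A\<close>, so that the fixed model \<open>B\<close> labels the
  vertices of \<open>A\<close>.\<close>

lemma digraph_iso_fst_sndE:
  assumes "digraph_iso A B" "tail A = fst" "head A = snd" "tail B = fst" "head B = snd"
  obtains g where "inj_on g (verts B)" "verts A = g ` verts B"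
    "\<And>u v. u \<in> verts B \<Longrightarrow> v \<in> verts B \<Longrightarrow> (g u, g v) \<in> arcs A \<longleftrightarrow> (u, v) \<in> arcs B"
proof -
  have "wf_digraph A"
    using assms(1) by (auto simp: digraph_iso_def pre_digraph.digraph_isomorphism_def)
  with assms(1) have "digraph_iso B A"
    by (rule digraph_iso_swap[rotated])
  then obtain h where h: "pre_digraph.digraph_isomorphism B h" "A = app_iso h B"
    by (auto simp: digraph_iso_def)
  define g where "g = iso_verts h"
  have inj: "inj_on g (verts B)" and wf: "wf_digraph B"
    using h(1) by (auto simp: pre_digraph.digraph_isomorphism_def g_def)
  have arc: "iso_arcs h e = (g (fst e), g (snd e))" if "e \<in> arcs B" for e
    using that h assms by (auto simp: pre_digraph.digraph_isomorphism_def g_def app_iso_def prod_eq_iff)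
  have ends: "fst e \<in> verts B" "snd e \<in> verts B" if "e \<in> arcs B" for e
    using wf_digraph.tail_in_verts[OF wf that] wf_digraph.head_in_verts[OF wf that] assms by auto
  show thesis
  proof
    show "verts A = g ` verts B"
      by (simp add: h(2) g_def)
    fix u v assume uv: "u \<in> verts B" "v \<in> verts B"
    show "(g u, g v) \<in> arcs A \<longleftrightarrow> (u, v) \<in> arcs B"
    proof
      assume "(g u, g v) \<in> arcs A"
      then obtain e where e: "e \<in> arcs B" "(g u, g v) = (g (fst e), g (snd e))"
        using arc by (auto simp: h(2))
      then have "e = (u, v)"
        using ends[OF e(1)] uv inj_onD[OF inj] by (metis prod.collapse prod.inject)
      then show "(u, v) \<in> arcs B"
        using e(1) by simp
    next
      assume e: "(u, v) \<in> arcs B"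
      then have "iso_arcs h (u, v) \<in> arcs A"
        unfolding h(2) by simp
      then show "(g u, g v) \<in> arcs A"
        using arc[OF e] by simp
    qed
  qed (fact inj)
qed

section \<open>Labelled icosahedra and their hats\<close>

definition icosahedron_in :: "'a pair_pre_digraph \<Rightarrow> (nat \<Rightarrow> 'a) \<Rightarrow> bool" where
  "icosahedron_in G f \<longleftrightarrow> inj_on f {..<12} \<and> f ` {..<12} \<subseteq> pverts G \<and>
     (\<forall>i<12. \<forall>j<12. (f i, f j) \<in> parcs G \<longleftrightarrow> j \<in> set (links ! i))"

definition hat_of :: "'a pair_pre_digraph \<Rightarrow> (nat \<Rightarrow> 'a) \<Rightarrow> nat set \<Rightarrow> 'a \<Rightarrow> bool" where
  "hat_of G f T v \<longleftrightarrow> v \<in> pverts G - f ` {..<12} \<and> (\<forall>i<12. (v, f i) \<in> parcs G \<longleftrightarrow> i \<in> T)"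

text \<open>This is a lower bound: \<open>H\<close> may omit vertices outside the icosahedron, since
  the pentagon graph can contain pentagons of other kinds.\<close>

definition has_hats :: "nat \<Rightarrow> 'a pair_pre_digraph \<Rightarrow> bool" where
  "has_hats n G \<longleftrightarrow> (\<exists>f H. icosahedron_in G f \<and> finite H \<and> card H = n \<and>
     (\<forall>v\<in>H. \<exists>x<12. \<exists>k<5. hat_of G f (set (tadpole_list x k)) v))"

lemma icosahedron_inD:
  assumes "icosahedron_in G f"
  shows "inj_on f {..<12}" "i < 12 \<Longrightarrow> f i \<in> pverts G"
    "i < 12 \<Longrightarrow> j < 12 \<Longrightarrow> (f i, f j) \<in> parcs G \<longleftrightarrow> j \<in> set (links ! i)"
  using assms by (auto simp: icosahedron_in_def)

lemma links_less:
  assumes "w < 12" "j \<in> set (links ! w)"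
  shows "j < 12"
  using links_sound assms by auto

lemma antidual_less: "i < 12 \<Longrightarrow> antidual ! i < 12"
  using antidual_sound by auto

lemma link_image:
  assumes "w < 12"
  shows "(\<lambda>i. g (links ! w ! i)) ` {..<5} = g ` set (links ! w)"
proof -
  have "length (links ! w) = 5"
    using links_sound assms by auto
  then have "set (links ! w) = (!) (links ! w) ` {..<5}"
    by (metis lessThan_atLeast0 list.set_map map_nth set_upt)
  then show ?thesis
    by (simp add: image_image)
qed

text \<open>The labelling \<open>g\<close> is arbitrary so that the lemma serves twice: with
  \<open>f\<close> for the links themselves, and with \<open>f(x := v)\<close> for links in which a
  hat replaces \<open>x\<close>.\<close>

lemma link_pentagonI:
  assumes "pair_graph G" "m < 12" "inj_on g (set (links ! m))" "g ` set (links ! m) \<subseteq> pverts G"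
    and arcs: "\<And>i j. i \<in> set (links ! m) \<Longrightarrow> j \<in> set (links ! m) \<Longrightarrow> (g i, g j) \<in> parcs G \<longleftrightarrow> j \<in> set (links ! i)"
  shows "induced G (g ` set (links ! m)) \<in> pverts (pentagon_graph G)"
proof -
  have len: "length (links ! m) = 5" and dist: "distinct (links ! m)"
    using links_sound \<open>m < 12\<close> by auto
  have "induced G ((\<lambda>i. g (links ! m ! i)) ` {..<5}) \<in> pverts (pentagon_graph G)"
  proof (rule induced_pentagonI[OF \<open>pair_graph G\<close>])
    show "inj_on (\<lambda>i. g (links ! m ! i)) {..<5}"
    proof (rule inj_onI)
      fix i j assume "i \<in> {..<5}" "j \<in> {..<5}" "g (links ! m ! i) = g (links ! m ! j)"
      then show "i = j"
        using inj_onD[OF assms(3)] len dist by (metis lessThan_iff nth_eq_iff_index_eq nth_mem)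
    qed
    show "(\<lambda>i. g (links ! m ! i)) ` {..<5} \<subseteq> pverts G"
      using assms(4) link_image[OF \<open>m < 12\<close>, of g] by simp
    fix i j :: nat assume ij: "i < 5" "j < 5"
    then have "(g (links ! m ! i), g (links ! m ! j)) \<in> parcs G \<longleftrightarrow> links ! m ! j \<in> set (links ! (links ! m ! i))"
      using arcs len by simp
    also have "\<dots> \<longleftrightarrow> (i, j) \<in> parcs cycle5"
      using links_pentagon ij \<open>m < 12\<close> by (simp add: cycle5_arc_iff)
    finally show "(g (links ! m ! i), g (links ! m ! j)) \<in> parcs G \<longleftrightarrow> (i, j) \<in> parcs cycle5" .
  qed
  then show ?thesis
    by (simp only: link_image[OF \<open>m < 12\<close>])
qed

lemma share_edge_iff:
  "share_edge A B \<longleftrightarrow> (\<exists>p\<in>set A \<inter> set B. \<exists>q\<in>set A \<inter> set B. q \<in> set (links ! p))"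
  by (auto simp: share_edge_def has_edge_def)

text \<open>As \<open>f\<close> is injective, intersections commute with images; common edges in
  \<open>G\<close> thereby reduce to the computable test on labels.\<close>

lemma image_share_edge_iff:
  assumes "icosahedron_in G f" "set A \<subseteq> {..<12}" "set B \<subseteq> {..<12}"
  shows "(\<exists>p\<in>f ` set A \<inter> f ` set B. \<exists>q\<in>f ` set A \<inter> f ` set B. (p, q) \<in> parcs G) \<longleftrightarrow> share_edge A B"
proof -
  have "f ` set A \<inter> f ` set B = f ` (set A \<inter> set B)"
    using icosahedron_inD(1)[OF assms(1)] assms(2,3) by (simp add: inj_on_image_Int)
  moreover have "(f p, f q) \<in> parcs G \<longleftrightarrow> q \<in> set (links ! p)" if "p \<in> set A \<inter> set B" "q \<in> set A \<inter> set B" for p q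
    using that assms(2,3) by (intro icosahedron_inD(3)[OF assms(1)]) auto
  ultimately show ?thesis
    by (simp add: share_edge_iff)
qed

section \<open>The icosahedron formed by the links\<close>

definition link_pentagon :: "'a pair_pre_digraph \<Rightarrow> (nat \<Rightarrow> 'a) \<Rightarrow> nat \<Rightarrow> 'a pair_pre_digraph" where
  "link_pentagon G f i = induced G (f ` set (links ! (antidual ! i)))"

definition hat_pentagon :: "'a pair_pre_digraph \<Rightarrow> (nat \<Rightarrow> 'a) \<Rightarrow> 'a \<Rightarrow> nat \<Rightarrow> nat \<Rightarrow> 'a pair_pre_digraph" where
  "hat_pentagon G f v x m = induced G (insert v (f ` set (remove1 x (links ! m))))"

lemma link_pentagon_in_pentagon_graph:
  assumes "pair_graph G" "icosahedron_in G f" "i < 12"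
  shows "link_pentagon G f i \<in> pverts (pentagon_graph G)"
  unfolding link_pentagon_def
proof (rule link_pentagonI[OF assms(1) antidual_less[OF assms(3)]])
  have sub: "set (links ! (antidual ! i)) \<subseteq> {..<12}"
    using links_less[OF antidual_less[OF assms(3)]] by auto
  then show "inj_on f (set (links ! (antidual ! i)))" "f ` set (links ! (antidual ! i)) \<subseteq> pverts G"
    using assms(2) by (auto simp: icosahedron_in_def inj_on_subset)
  show "(f p, f q) \<in> parcs G \<longleftrightarrow> q \<in> set (links ! p)"
    if "p \<in> set (links ! (antidual ! i))" "q \<in> set (links ! (antidual ! i))" for p q
    using that sub assms(2) by (auto simp: icosahedron_in_def)
qed

lemma icosahedron_in_pentagon_graph:
  assumes "pair_graph G" "icosahedron_in G f"
  shows "icosahedron_in (pentagon_graph G) (link_pentagon G f)"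
proof -
  have sub: "set (links ! (antidual ! i)) \<subseteq> {..<12}" if "i < 12" for i
    using links_less[OF antidual_less[OF that]] by auto
  have inj: "i = j" if ij: "i < 12" "j < 12" and eq: "link_pentagon G f i = link_pentagon G f j" for i j
  proof -
    have "f ` set (links ! (antidual ! i)) = f ` set (links ! (antidual ! j))"
      using eq by (simp add: link_pentagon_def induced_def)
    then have "set (links ! (antidual ! i)) = set (links ! (antidual ! j))"
      using inj_on_image_eq_iff[OF icosahedron_inD(1)[OF assms(2)] sub sub] ij by simp
    then have "antidual ! i = antidual ! j"
      using links_inj antidual_less[OF ij(1)] antidual_less[OF ij(2)] by auto
    then show ?thesis
      using antidual_inj ij by (simp add: nth_eq_iff_index_eq)
  qed
  have "(link_pentagon G f i, link_pentagon G f j) \<in> parcs (pentagon_graph G) \<longleftrightarrow> j \<in> set (links ! i)"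
    if "i < 12" "j < 12" for i j
  proof -
    have "(link_pentagon G f i, link_pentagon G f j) \<in> parcs (pentagon_graph G) \<longleftrightarrow>
        f ` set (links ! (antidual ! i)) \<noteq> f ` set (links ! (antidual ! j)) \<and>
        share_edge (links ! (antidual ! i)) (links ! (antidual ! j))"
      using link_pentagon_in_pentagon_graph[OF assms] that image_share_edge_iff[OF assms(2) sub sub, of i j]
      unfolding link_pentagon_def by (subst pentagon_graph_arc_iff) auto
    \<comment> \<open>By injectivity, distinct vertex sets mean distinct indices, which is the form
      of the table \<open>links_share_edge\<close>.\<close>
    also have "\<dots> \<longleftrightarrow> i \<noteq> j \<and> share_edge (links ! (antidual ! i)) (links ! (antidual ! j))"
      using inj[OF that] by (auto simp: link_pentagon_def induced_def)
    also have "\<dots> \<longleftrightarrow> j \<in> set (links ! i)"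
      using links_share_edge that by auto
    finally show ?thesis .
  qed
  then show ?thesis
    using inj link_pentagon_in_pentagon_graph[OF assms] by (auto simp: icosahedron_in_def inj_on_def)
qed

section \<open>Pentagons through a hat\<close>

context
  fixes G :: "'a pair_pre_digraph" and f :: "nat \<Rightarrow> 'a" and x k m :: nat and v :: 'a
  assumes pair: "pair_graph G" and ico: "icosahedron_in G f" and x: "x < 12" and k: "k < 5"
    and hat: "hat_of G f (set (tadpole_list x k)) v" and m: "m \<in> set (hat_centres x k)"
begin

lemma hat_centre: "m < 12" "x \<in> set (links ! m)"
  using hat_centres_sound x k m by auto

lemma set_remove1_links: "set (remove1 x (links ! m)) = set (links ! m) - {x}"
  using links_sound hat_centre(1) by simp

lemma links_hat_centre: "set (links ! m) \<subseteq> {..<12}"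
  using links_less[OF hat_centre(1)] by auto

lemma hat_new: "v \<in> pverts G" "v \<notin> f ` {..<12}"
  using hat by (auto simp: hat_of_def)

lemma hat_pentagon_in_pentagon_graph: "hat_pentagon G f v x m \<in> pverts (pentagon_graph G)"
proof -
  interpret pair_graph G by (fact pair)
  have sym: "(a, b) \<in> parcs G \<longleftrightarrow> (b, a) \<in> parcs G" for a b
    using arcs_symmetric by blast
  let ?g = "f(x := v)"
  have image: "?g ` set (links ! m) = insert v (f ` set (remove1 x (links ! m)))"
    using hat_centre(2) by (auto simp: set_remove1_links)
  have f_arc: "(f p, f q) \<in> parcs G \<longleftrightarrow> q \<in> set (links ! p)" if "p < 12" "q < 12" for p q
    using ico that by (simp add: icosahedron_in_def)
  \<comment> \<open>On the rest of the link, \<open>v\<close> imitates \<open>x\<close>.\<close>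
  have v_arc: "(v, f q) \<in> parcs G \<longleftrightarrow> q \<in> set (links ! x)" if "q \<in> set (links ! m)" "q \<noteq> x" for q
  proof -
    have "q < 12" using that links_hat_centre by auto
    then have "(v, f q) \<in> parcs G \<longleftrightarrow> q \<in> set (tadpole_list x k)"
      using hat by (simp add: hat_of_def)
    also have "\<dots> \<longleftrightarrow> q \<in> set (links ! x)"
      using hat_centres_sound x k m that set_remove1_links by auto
    finally show ?thesis .
  qed
  have "induced G (?g ` set (links ! m)) \<in> pverts (pentagon_graph G)"
  proof (rule link_pentagonI[OF pair hat_centre(1)])
    have "inj_on f {..<12}" using ico by (simp add: icosahedron_in_def)
    then show "inj_on ?g (set (links ! m))"
      using links_hat_centre hat_new(2) by (intro inj_on_fun_updI) (auto intro: inj_on_subset)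
    show "?g ` set (links ! m) \<subseteq> pverts G"
      using ico links_hat_centre hat_new(1) by (auto simp: icosahedron_in_def)
    fix i j assume ij: "i \<in> set (links ! m)" "j \<in> set (links ! m)"
    then have less: "i < 12" "j < 12"
      using links_hat_centre by auto
    show "(?g i, ?g j) \<in> parcs G \<longleftrightarrow> j \<in> set (links ! i)"
    proof (cases "i = x")
      case True
      have "(v, v) \<notin> parcs G" "x \<notin> set (links ! x)"
        using no_loops'[of v v] links_sound x by auto
      with True show ?thesis
        using v_arc[OF ij(2)] by (cases "j = x") auto
    next
      case False
      \<comment> \<open>The symmetry of the table is read off from the symmetry of
        \<open>G\<close>.\<close>
      have "x \<in> set (links ! i) \<longleftrightarrow> i \<in> set (links ! x)"
        using f_arc[OF less(1) x] f_arc[OF x less(1)] sym by blast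
      then show ?thesis
        using False v_arc[OF ij(1)] sym[of "f i" v] f_arc[OF less] by auto
    qed
  qed
  then show ?thesis
    by (simp only: image hat_pentagon_def)
qed

text \<open>No link contains \<open>v\<close>, so a shared edge must join two of the four old
  vertices. The links that share one are then given by \<open>hat_centres_tadpole\<close>.\<close>

lemma hat_pentagon_hat:
  "\<exists>y<12. \<exists>j<5. hat_of (pentagon_graph G) (link_pentagon G f) (set (tadpole_list y j)) (hat_pentagon G f v x m)"
proof -
  define s where "s = filter (\<lambda>i. share_edge (remove1 x (links ! m)) (links ! (antidual ! i))) [0..<12]"
  have "sorted_tadpole s"
    using hat_centres_tadpole x k m by (simp add: s_def)
  then obtain y j where y: "y \<in> set s" "j < 5" "sort (tadpole_list y j) = s"
    by (auto simp: sorted_tadpole_def)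
  then have T: "set (tadpole_list y j) = set s"
    by (metis set_sort)
  have "hat_of (pentagon_graph G) (link_pentagon G f) (set s) (hat_pentagon G f v x m)"
    unfolding hat_of_def
  proof (intro conjI allI impI)
    have sub: "set (links ! (antidual ! i)) \<subseteq> {..<12}" if "i < 12" for i
      using links_less[OF antidual_less[OF that]] by auto
    have new: "v \<notin> f ` set (links ! (antidual ! i))" if "i < 12" for i
      using sub[OF that] hat_new(2) by auto
    have "v \<in> pverts (hat_pentagon G f v x m)"
      by (simp add: hat_pentagon_def induced_def)
    moreover have "v \<notin> pverts (link_pentagon G f i)" if "i < 12" for i
      using new[OF that] by (simp add: link_pentagon_def induced_def)
    ultimately have "hat_pentagon G f v x m \<noteq> link_pentagon G f i" if "i < 12" for i
      using that by metis
    then show "hat_pentagon G f v x m \<in> pverts (pentagon_graph G) - link_pentagon G f ` {..<12}"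
      using hat_pentagon_in_pentagon_graph by auto
    fix i :: nat assume i: "i < 12"
    have inter: "insert v (f ` set (remove1 x (links ! m))) \<inter> f ` set (links ! (antidual ! i)) =
        f ` set (remove1 x (links ! m)) \<inter> f ` set (links ! (antidual ! i))"
      using new[OF i] by auto
    have "set (remove1 x (links ! m)) \<subseteq> {..<12}"
      using links_hat_centre set_remove1_links by auto
    note share = image_share_edge_iff[OF ico this sub[OF i]]
    have "insert v (f ` set (remove1 x (links ! m))) \<noteq> f ` set (links ! (antidual ! i))"
      using new[OF i] by auto
    then have "(hat_pentagon G f v x m, link_pentagon G f i) \<in> parcs (pentagon_graph G) \<longleftrightarrow>
        share_edge (remove1 x (links ! m)) (links ! (antidual ! i))"
      using pentagon_graph_arc_iff[OF hat_pentagon_in_pentagon_graph[unfolded hat_pentagon_def]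
          link_pentagon_in_pentagon_graph[OF pair ico i, unfolded link_pentagon_def]]
      unfolding hat_pentagon_def link_pentagon_def inter share by simp
    also have "\<dots> \<longleftrightarrow> i \<in> set s"
      using i by (simp add: s_def)
    finally show "(hat_pentagon G f v x m, link_pentagon G f i) \<in> parcs (pentagon_graph G) \<longleftrightarrow> i \<in> set s" .
  qed
  moreover have "y < 12"
    using y(1) by (simp add: s_def)
  ultimately show ?thesis
    using y(2) unfolding T[symmetric] by blast
qed

end

section \<open>Doubling and iteration\<close>

lemma has_hats_pentagon_graph:
  assumes "pair_graph G" "has_hats n G"
  shows "has_hats (2 * n) (pentagon_graph G)"
proof -
  obtain f H where f: "icosahedron_in G f" and H: "finite H" "card H = n"
    "\<forall>v\<in>H. \<exists>x<12. \<exists>k<5. hat_of G f (set (tadpole_list x k)) v"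
    using assms(2) by (auto simp: has_hats_def)
  then obtain x k where xk: "\<And>v. v \<in> H \<Longrightarrow> x v < 12 \<and> k v < 5 \<and> hat_of G f (set (tadpole_list (x v) (k v))) v"
    by metis
  \<comment> \<open>The Boolean selects one of the two centres, so new hats are indexed by
    \<open>H \<times> UNIV\<close>.\<close>
  define c where "c v b = hat_centres (x v) (k v) ! (if b then 0 else 1)" for v b
  have c: "c v b \<in> set (hat_centres (x v) (k v))" for v b
    by (auto simp: c_def hat_centres_def Let_def)
  define P where "P = (\<lambda>(v, b). hat_pentagon G f v (x v) (c v b))"
  have new: "v \<notin> f ` {..<12}" if "v \<in> H" for v
    using xk[OF that] by (auto simp: hat_of_def)
  have base: "set (remove1 (x v) (links ! c v b)) \<subseteq> {..<12}" if "v \<in> H" for v b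
  proof -
    have "c v b < 12"
      using hat_centres_sound xk[OF that] c[of v b] by auto
    then show ?thesis
      using links_less set_remove1_subset by fastforce
  qed
  have "inj_on P (H \<times> UNIV)"
  proof (rule inj_onI, clarify)
    fix v b w d assume vw: "v \<in> H" "w \<in> H" and "P (v, b) = P (w, d)"
    then have eq: "insert v (f ` set (remove1 (x v) (links ! c v b))) = insert w (f ` set (remove1 (x w) (links ! c w d)))"
      by (simp add: P_def hat_pentagon_def induced_def)
    \<comment> \<open>The hat is recovered as the only vertex of the pentagon outside the
      icosahedron.\<close>
    have "v = w"
      using eq new[OF vw(1)] base[OF vw(2), of d] by blast
    have "v \<notin> f ` set (remove1 (x v) (links ! c v e))" for e
      using new[OF vw(1)] base[OF vw(1), of e] by auto
    then have "f ` set (remove1 (x v) (links ! c v b)) = f ` set (remove1 (x v) (links ! c v d))"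
      using eq unfolding \<open>v = w\<close>[symmetric] by (metis insert_ident)
    then have "set (remove1 (x v) (links ! c v b)) = set (remove1 (x v) (links ! c v d))"
      using inj_on_image_eq_iff[OF icosahedron_inD(1)[OF f] base[OF vw(1)] base[OF vw(1)]] by simp
    moreover have "\<not> set (remove1 (x v) (links ! c v True)) \<subseteq> set (remove1 (x v) (links ! c v False))"
      using hat_centres_distinct xk[OF vw(1)] by (simp add: c_def)
    ultimately have "b = d"
      by (cases b; cases d) auto
    with \<open>v = w\<close> show "v = w \<and> b = d" by simp
  qed
  then have "card (P ` (H \<times> UNIV)) = 2 * n"
    using H(2) by (simp add: card_image card_cartesian_product)
  moreover have "\<forall>p\<in>P ` (H \<times> UNIV). \<exists>y<12. \<exists>j<5.
      hat_of (pentagon_graph G) (link_pentagon G f) (set (tadpole_list y j)) p"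
  proof clarify
    fix v b assume "v \<in> H"
    then show "\<exists>y<12. \<exists>j<5. hat_of (pentagon_graph G) (link_pentagon G f) (set (tadpole_list y j)) (P (v, b))"
      using hat_pentagon_hat[OF assms(1) f _ _ _ c] xk by (simp add: P_def)
  qed
  moreover have "finite (P ` (H \<times> UNIV))"
    using H(1) by simp
  ultimately show ?thesis
    unfolding has_hats_def using icosahedron_in_pentagon_graph[OF assms(1) f] by blast
qed

lemma has_hats_rename:
  assumes "pair_graph G" "has_hats n G" "inj_on r (pverts G)"
  shows "has_hats n (rename r G)"
proof -
  interpret pair_graph G by fact
  obtain f H where f: "icosahedron_in G f" and H: "finite H" "card H = n"
    "\<forall>v\<in>H. \<exists>x<12. \<exists>k<5. hat_of G f (set (tadpole_list x k)) v"
    using assms(2) by (auto simp: has_hats_def)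
  have fv: "f i \<in> pverts G" if "i < 12" for i
    using f that by (auto simp: icosahedron_in_def)
  have arc: "(r a, r b) \<in> parcs (rename r G) \<longleftrightarrow> (a, b) \<in> parcs G" if "a \<in> pverts G" "b \<in> pverts G" for a b
  proof
    assume "(r a, r b) \<in> parcs (rename r G)"
    then obtain a' b' where ab: "(a', b') \<in> parcs G" "r a = r a'" "r b = r b'"
      by (auto simp: rename_def)
    then have "a = a'" "b = b'"
      using inj_onD[OF assms(3)] that in_arcsD1 in_arcsD2 by metis+
    with ab(1) show "(a, b) \<in> parcs G" by simp
  qed (force simp: rename_def)
  have "icosahedron_in (rename r G) (r \<circ> f)"
    using f arc fv assms(3) by (auto simp: icosahedron_in_def rename_def intro!: comp_inj_on intro: inj_on_subset)
  moreover have HV: "H \<subseteq> pverts G"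
    using H(3) by (auto simp: hat_of_def)
  then have "card (r ` H) = n"
    using H(2) assms(3) by (metis card_image inj_on_subset)
  moreover have "hat_of (rename r G) (r \<circ> f) T (r v)" if "v \<in> H" "hat_of G f T v" for v T
  proof -
    have "r v \<noteq> r (f i)" if "i < 12" for i
      using fv[OF that] \<open>hat_of G f T v\<close> inj_onD[OF assms(3), of v "f i"] that by (auto simp: hat_of_def)
    then show ?thesis
      using that arc fv by (auto simp: hat_of_def rename_def)
  qed
  then have "\<forall>v\<in>r ` H. \<exists>x<12. \<exists>k<5. hat_of (rename r G) (r \<circ> f) (set (tadpole_list x k)) v"
    using H(3) by blast
  ultimately show ?thesis
    using H(1) unfolding has_hats_def by blast
qed

lemma has_hats_iterated_pentagon_graph:
  assumes "pair_graph G" "has_hats n G"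
  shows "has_hats (2 ^ k * n) (iterated_pentagon_graph k G)"
proof (induction k)
  case 0
  then show ?case
    using has_hats_rename[OF assms, of Original] by (simp add: inj_on_def)
next
  case (Suc k)
  have p: "pair_graph (iterated_pentagon_graph k G)"
    using assms(1) by (rule pair_graph_iterated_pentagon_graph)
  have "has_hats (2 * (2 ^ k * n)) (pentagon_graph (iterated_pentagon_graph k G))"
    by (rule has_hats_pentagon_graph[OF p Suc.IH])
  from has_hats_rename[OF pair_graph_pentagon_graph[OF p] this inj_on_pentagon_name[OF p]]
  show ?case
    by (simp add: mult.assoc)
qed

lemma has_hats_card:
  assumes "pair_graph G" "has_hats n G"
  shows "n \<le> card (pverts G)"
proof -
  interpret pair_graph G by fact
  obtain f H where "finite H" "card H = n"
    "\<forall>v\<in>H. \<exists>x<12. \<exists>k<5. hat_of G f (set (tadpole_list x k)) v"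
    using assms(2) by (auto simp: has_hats_def)
  moreover from this(3) have "H \<subseteq> pverts G"
    by (auto simp: hat_of_def)
  ultimately show ?thesis
    using card_mono[OF pair_finite_verts] by auto
qed

section \<open>From the given graph to labelled hats\<close>

lemma tadpole_arc_iff:
  "(i, j) \<in> parcs tadpole_3_1 \<longleftrightarrow> (i, j) \<in> {(0,1), (1,2), (2,0), (0,3), (1,0), (2,1), (0,2), (3,0)}"
  by (auto simp: tadpole_3_1_def undirected_def)

text \<open>Both isomorphisms become labellings; \<open>tadpole_complete\<close> then identifies the
  labels of each tadpole with some \<open>tadpole_list\<close>.\<close>

lemma icosahedron_with_tadpole_hats_has_hats:
  assumes "icosahedron_with_tadpole_hats h G"
  shows "has_hats h G"
proof -
  have "pair_graph G"
    using assms by (simp add: icosahedron_with_tadpole_hats_def)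
  then interpret pair_graph G .
  obtain S where S: "S \<subseteq> pverts G" "digraph_iso (with_proj G \<restriction> S) (with_proj icosahedron)"
      "card (pverts G - S) = h" and hats: "\<forall>v \<in> pverts G - S. tadpole_hat G S v"
    using assms by (auto simp: icosahedron_with_tadpole_hats_def)
  obtain f where f: "inj_on f {..<12}" "S = f ` {..<12}"
      "\<And>u v. u < 12 \<Longrightarrow> v < 12 \<Longrightarrow> (f u, f v) \<in> arcs (with_proj G \<restriction> S) \<longleftrightarrow> (u, v) \<in> parcs icosahedron"
    using S(2) by (elim digraph_iso_fst_sndE) (auto simp: icosahedron_verts)
  have f_arc: "(f u, f v) \<in> parcs G \<longleftrightarrow> v \<in> set (links ! u)" if "u < 12" "v < 12" for u v
    using f(3)[OF that] that f(2) by (simp add: icosahedron_arc_iff)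
  then have ico: "icosahedron_in G f"
    using f S(1) by (simp add: icosahedron_in_def)
  have "\<exists>x<12. \<exists>k<5. hat_of G f (set (tadpole_list x k)) v" if v: "v \<in> pverts G - S" for v
  proof -
    obtain T :: "'a pair_pre_digraph" where T: "induced_subgraph (with_proj T) (with_proj G \<restriction> S)"
        "digraph_iso (with_proj T) (with_proj tadpole_3_1)" "{u \<in> S. (v, u) \<in> parcs G} = pverts T"
      using hats v by (auto simp: tadpole_hat_def)
    obtain e where e: "inj_on e {..<4}" "pverts T = e ` {..<4}"
        "\<And>i j. i < 4 \<Longrightarrow> j < 4 \<Longrightarrow> (e i, e j) \<in> parcs T \<longleftrightarrow> (i, j) \<in> parcs tadpole_3_1"
      using T(2) by (elim digraph_iso_fst_sndE) (auto simp: tadpole_3_1_def undirected_def)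
    have TS: "pverts T \<subseteq> S"
      using T(3) by auto
    have "\<exists>n<12. e i = f n" if "i < 4" for i
      using that TS e(2) f(2) by auto
    \<comment> \<open>\<open>t i\<close> is the icosahedron label of vertex \<open>i\<close> of the
      tadpole.\<close>
    then obtain t where t: "\<And>i. i < 4 \<Longrightarrow> t i < 12 \<and> e i = f (t i)"
      by metis
    have t_arc: "t j \<in> set (links ! t i) \<longleftrightarrow> (i, j) \<in> parcs tadpole_3_1" if "i < 4" "j < 4" for i j
    proof -
      have "(e i, e j) \<in> parcs T \<longleftrightarrow> (e i, e j) \<in> parcs G"
        using T(1) TS e(2) that by (auto simp: induced_subgraph_def)
      then show ?thesis
        using e(3)[OF that] f_arc t that by simp
    qed
    have t_neq: "t i \<noteq> t j" if "i < 4" "j < 4" "i \<noteq> j" for i j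
      using e(1) t that by (metis inj_onD lessThan_iff)
    have four: "{..<4} = {0, 1, 2, 3::nat}"
      by (simp add: set_eq_iff) presburger
    \<comment> \<open>In \<open>tadpole_3_1\<close> the vertex 0 has degree three, 1 and 2 complete
      the triangle and 3 is pendant.\<close>
    have "\<exists>k\<in>set [0..<5]. sort (tadpole_list (t 0) k) = sort [t 0, t 1, t 2, t 3]"
    proof (rule tadpole_complete[rule_format])
      show "t 0 \<in> set [0..<12]" "t 1 \<in> set (links ! t 0)"
          "t 2 \<in> set (filter (\<lambda>z. z \<in> set (links ! t 1)) (links ! t 0))"
          "t 3 \<in> set (filter (\<lambda>u. u \<noteq> t 1 \<and> u \<noteq> t 2 \<and> u \<notin> set (links ! t 1) \<and> u \<notin> set (links ! t 2)) (links ! t 0))"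
        using t[of 0] t_neq by (simp_all add: t_arc tadpole_arc_iff)
    qed
    then obtain k where k: "k < 5" "sort (tadpole_list (t 0) k) = sort [t 0, t 1, t 2, t 3]"
      by auto
    then have "set (tadpole_list (t 0) k) = set [t 0, t 1, t 2, t 3]"
      by (metis set_sort)
    then have "set (tadpole_list (t 0) k) = t ` {..<4}"
      by (auto simp: four)
    moreover have "(v, f i) \<in> parcs G \<longleftrightarrow> i \<in> t ` {..<4}" if "i < 12" for i
    proof -
      have "(v, f i) \<in> parcs G \<longleftrightarrow> f i \<in> e ` {..<4}"
        using T(3) e(2) f(2) that by auto
      also have "e ` {..<4} = f ` t ` {..<4}"
        using t by (auto simp: image_iff)
      also have "f i \<in> \<dots> \<longleftrightarrow> i \<in> t ` {..<4}"
        using f(1) t that by (intro inj_on_image_mem_iff) auto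
      finally show ?thesis .
    qed
    ultimately have "hat_of G f (set (tadpole_list (t 0) k)) v"
      using v f(2) by (simp add: hat_of_def)
    then show ?thesis
      using k(1) t[of 0] by auto
  qed
  then show ?thesis
    using ico S(3) pair_finite_verts unfolding has_hats_def by blast
qed

theorem theorem3p5:
  fixes h :: nat and G :: "'a pair_pre_digraph"
  assumes "h > 0"
    and "icosahedron_with_tadpole_hats h G"
  shows "pentagon_expanding G"
proof -
  have p: "pair_graph G"
    using assms(2) by (simp add: icosahedron_with_tadpole_hats_def)
  \<comment> \<open>There are at least \<open>2 ^ k * h\<close> hats after \<open>k\<close> steps;
    the weaker bound \<open>k\<close> suffices for divergence.\<close>
  have "k \<le> card (pverts (iterated_pentagon_graph k G))" for k
  proof -
    have "k \<le> 2 ^ k * h"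
      using less_exp[of k] assms(1) by (metis less_imp_le mult_le_mono nat_mult_1_right One_nat_def Suc_leI)
    also have "\<dots> \<le> card (pverts (iterated_pentagon_graph k G))"
      using has_hats_card[OF pair_graph_iterated_pentagon_graph[OF p] has_hats_iterated_pentagon_graph[OF p]]
        icosahedron_with_tadpole_hats_has_hats[OF assms(2)] by simp
    finally show ?thesis .
  qed
  then show ?thesis
    unfolding pentagon_expanding_def
    by (intro filterlim_at_top_mono[OF filterlim_ident]) auto
qed

end
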